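(* Let $m>0$ be a real number and let $f(x)=x^{-m}$ for all real $x>0$. Let $S=\{x_1,x_2,\dots,x_n\}$ be a set of $n$ distinct positive integers. (a) For any such set $S$, $i_{+}([S^{\ast\ast}]_f)=n$ and $i_{-}([S^{\ast\ast}]_f)=i_{0}([S^{\ast\ast}]_f)=0$. (b) If $S$ is UD-closed, then $i_{+}((S^{\ast\ast})_f)$ is the number of $x_i\in S$ such that $\omega(x_i)$ is even, $i_{-}((S^{\ast\ast})_f)$ is the number of $x_i\in S$ such that $\omega(x_i)$ is odd, and $i_{0}((S^{\ast\ast})_f)=0$.
   Context: A positive divisor $d$ of a positive integer $n$ is a unitary divisor of $n$, written $d\parallel n$, if $\gcd(d,n/d)=1$. For positive integers $a,b$, $(a,b)^{\ast\ast}$ denotes the greatest common unitary divisor of $a$ and $b$ (the largest $d$ with $d\parallel a$ and $d\parallel b$), and $[a,b]^{\ast\ast}=ab/(a,b)^{\ast\ast}$ is the pseudo-LCUM (pseudo least common unitary multiple). For a set $S=\{x_1,\dots,x_n\}$ of distinct positive integers, $(S^{\ast\ast})_f$ is the $n\times n$ matrix with $ij$ entry $f((x_i,x_j)^{\ast\ast})$, and $[S^{\ast\ast}]_f$ is the $n\times n$ matrix with $ij$ entry $f([x_i,x_j]^{\ast\ast})$. $S$ is UD-closed (unitary divisor closed) if every unitary divisor of every element of $S$ belongs to $S$. For a Hermitian matrix $H$, $i_{+}(H)$, $i_{-}(H)$, $i_0(H)$ denote the numbers of positive, negative and zero eigenvalues of $H$, respectively, counted with multiplicity. $\omega(x)$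 is the number of distinct prime factors of $x$, with $\omega(1)=0$. *)

theory Defs
  imports
    Complex_Main
    "HOL-Computational_Algebra.Primes"
    "Jordan_Normal_Form.Char_Poly"
begin

definition unitary_divisor :: "nat \<Rightarrow> nat \<Rightarrow> bool" where
  "unitary_divisor d n \<longleftrightarrow> 0 < n \<and> d dvd n \<and> coprime d (n div d)"

definition gcud :: "nat \<Rightarrow> nat \<Rightarrow> nat" where
  "gcud a b = Max {d. unitary_divisor d a \<and> unitary_divisor d b}"

(* For positive a and b the division is exact, since gcud a b divides a. *)
definition pseudo_lcum :: "nat \<Rightarrow> nat \<Rightarrow> nat" where
  "pseudo_lcum a b = a * b div gcud a b"

definition UD_closed :: "nat set \<Rightarrow> bool" where
  "UD_closed S \<longleftrightarrow> (\<forall>a\<in>S. \<forall>d. unitary_divisor d a \<longrightarrow> d \<in> S)"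

definition omega :: "nat \<Rightarrow> nat" where
  "omega a = card (prime_factors a)"

(* The set {x_1, ..., x_n} is given by an enumeration x, with indices shifted to 0, ..., n - 1
   as for the type mat.  The real entries are embedded into the complex numbers so that
   the inertia of Hermitian matrices below applies. *)

definition gcud_mat :: "(real \<Rightarrow> real) \<Rightarrow> nat \<Rightarrow> (nat \<Rightarrow> nat) \<Rightarrow> complex mat" where
  "gcud_mat f n x = mat n n (\<lambda>(i, j). complex_of_real (f (real (gcud (x i) (x j)))))"

definition pseudo_lcum_mat :: "(real \<Rightarrow> real) \<Rightarrow> nat \<Rightarrow> (nat \<Rightarrow> nat) \<Rightarrow> complex mat" where
  "pseudo_lcum_mat f n x =
     mat n n (\<lambda>(i, j). complex_of_real (f (real (pseudo_lcum (x i) (x j)))))"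

(* The inertia is meant for Hermitian H, whose eigenvalues are all real.
   The multiplicity of an eigenvalue is its multiplicity as a root of the characteristic
   polynomial; this is nonzero, so order is genuine and the sums are finite. *)

definition i_plus :: "complex mat \<Rightarrow> nat" where
  "i_plus H = (\<Sum>r | eigenvalue H (complex_of_real r) \<and> r > 0.
     order (complex_of_real r) (char_poly H))"

definition i_minus :: "complex mat \<Rightarrow> nat" where
  "i_minus H = (\<Sum>r | eigenvalue H (complex_of_real r) \<and> r < 0.
     order (complex_of_real r) (char_poly H))"

definition i_zero :: "complex mat \<Rightarrow> nat" where
  "i_zero H = (\<Sum>r | eigenvalue H (complex_of_real r) \<and> r = 0.
     order (complex_of_real r) (char_poly H))"

end

theory Submission
  imports Defs "Jordan_Normal_Form.Schur_Decomposition"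
begin

text \<open>
  Both matrices are, up to a positive diagonal scaling, of the form \<open>((x\<^sub>i, x\<^sub>j)\<^sup>s)\<close> for the greatest
  common unitary divisor and a real exponent \<open>s\<close>: for the gcud matrix \<open>s = -m\<close>, and for the
  pseudo-LCUM matrix \<open>s = m\<close>, because
  \<open>[a, b]\<^bsup>-m\<^esup> = a\<^bsup>-m\<^esup> b\<^bsup>-m\<^esup> (a, b)\<^sup>m\<close>.

  The arithmetic input is a unitary Moebius inversion of the power function. With
  \<open>J\<^sub>s(d) = \<Prod>\<^bsub>p\<^sup>k \<parallel> d\<^esub> (p\<^bsup>ks\<^esup> - 1)\<close> one has \<open>(a, b)\<^sup>s = \<Sum> J\<^sub>s(d)\<close>, summed over
  the common unitary divisors \<open>d\<close> of \<open>a\<close> and \<open>b\<close> (\<open>sum_unitary_jordan_common_divisors\<close>).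
  Hence the Hermitian form of the matrix is a weighted sum of squares
  \<open>\<Sum>\<^sub>d J\<^sub>s(d) \<bar>l\<^sub>d(v)\<bar>\<^sup>2\<close>, where \<open>l\<^sub>d(v)\<close> adds up the \<open>v\<^sub>j\<close> (scaled) with \<open>d \<parallel> x\<^sub>j\<close>.
  The forms \<open>l\<^sub>d\<close> with \<open>d \<in> S\<close> alone already separate vectors, since unitary divisibility is
  triangular with respect to size (\<open>unitary_divisibility_injective\<close>).

  Such a representation controls the inertia
  (\<open>inertia_of_weighted_squares\<close>, a one-sided law of inertia): all but at most as many eigenvalues
  as there are nonpositive weights are positive, and likewise with the signs exchanged. It follows
  from the spectral theorem by comparing the representation with the one given by eigenvectors.

  For \<open>s = m > 0\<close> every weight is positive, so every eigenvalue is. For \<open>s = -m < 0\<close> the weight of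
  \<open>d\<close> has the sign \<open>(-1)\<^bsup>\<omega>(d)\<^esup>\<close>; if \<open>S\<close> is UD-closed, only the \<open>d \<in> S\<close> occur, so there are exactly
  \<open>n\<close> nonzero weights for \<open>n\<close> eigenvalues, and the two one-sided bounds force the numbers of
  positive and negative eigenvalues.
\<close>

section \<open>Weighted sums of squares\<close>

lemma homogeneous_system_nontrivial:
  fixes c :: "'k \<Rightarrow> 'i \<Rightarrow> 'a :: field"
  assumes "finite K" "finite N" "card K < card N"
  shows "\<exists>v. (\<exists>i\<in>N. v i \<noteq> 0) \<and> (\<forall>k\<in>K. (\<Sum>i\<in>N. c k i * v i) = 0)"
  using assms
proof (induction K arbitrary: c N rule: finite_induct)
  case empty
  then have "N \<noteq> {}" by auto
  then show ?case by (intro exI[of _ "\<lambda>_. 1"]) auto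
next
  case (insert k K)
  show ?case
  proof (cases "\<forall>i\<in>N. c k i = 0")
    case True
    from insert.prems insert.hyps have "card K < card N" by simp
    from insert.IH[OF insert.prems(1) this, of c] True show ?thesis
      by (auto intro!: sum.neutral)
  next
    case False
    then obtain j where j: "j \<in> N" "c k j \<noteq> 0" by blast
    define N' where "N' = N - {j}"
    have N': "finite N'" "card K < card N'" "j \<notin> N'" and N: "N = insert j N'"
      using insert.prems insert.hyps j by (auto simp: N'_def)
    from insert.IH[OF N'(1,2), of "\<lambda>l i. c l i - c l j * (c k i / c k j)"]
    obtain v where v: "\<exists>i\<in>N'. v i \<noteq> 0"
      and eqs: "\<And>l. l \<in> K \<Longrightarrow> (\<Sum>i\<in>N'. (c l i - c l j * (c k i / c k j)) * v i) = 0"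
      by blast
    \<comment> \<open>Equation \<open>k\<close> is solved for the unknown \<open>j\<close>.\<close>
    define s where "s = (\<Sum>i\<in>N'. (c k i / c k j) * v i)"
    define w where "w = v(j := - s)"
    have split: "(\<Sum>i\<in>N. c l i * w i) = (\<Sum>i\<in>N'. c l i * v i) - c l j * s" for l
    proof -
      have "(\<Sum>i\<in>N'. c l i * w i) = (\<Sum>i\<in>N'. c l i * v i)"
        using N'(3) by (intro sum.cong) (auto simp: w_def)
      then show ?thesis unfolding N using N' by (simp add: w_def)
    qed
    have "(\<Sum>i\<in>N. c k i * w i) = 0"
    proof -
      have "c k j * s = (\<Sum>i\<in>N'. c k i * v i)"
        unfolding s_def sum_distrib_left using j by (intro sum.cong) auto
      then show ?thesis by (simp add: split)
    qed
    moreover have "(\<Sum>i\<in>N. c l i * w i) = 0" if "l \<in> K" for l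
    proof -
      have "(\<Sum>i\<in>N'. (c l i - c l j * (c k i / c k j)) * v i)
            = (\<Sum>i\<in>N'. c l i * v i) - c l j * s"
        unfolding s_def sum_distrib_left sum_subtractf[symmetric]
        by (intro sum.cong) (auto simp: algebra_simps)
      then show ?thesis using eqs[OF that] by (simp add: split)
    qed
    moreover have "\<exists>i\<in>N. w i \<noteq> 0" using v N'(3) by (auto simp: N w_def)
    ultimately show ?thesis by (intro exI[of _ w]) auto
  qed
qed

lemma hermitian_form_weighted_squares:
  fixes E :: "'i \<Rightarrow> 'k \<Rightarrow> complex" and h :: "'k \<Rightarrow> real"
  assumes "finite I" "finite J"
    and A: "\<And>i j. i \<in> I \<Longrightarrow> j \<in> I \<Longrightarrow> A i j = (\<Sum>k\<in>J. of_real (h k) * E i k * cnj (E j k))"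
  shows "(\<Sum>i\<in>I. \<Sum>j\<in>I. cnj (v i) * A i j * v j)
       = of_real (\<Sum>k\<in>J. h k * (cmod (\<Sum>j\<in>I. cnj (E j k) * v j))\<^sup>2)"
proof -
  let ?s = "\<lambda>k. \<Sum>j\<in>I. cnj (E j k) * v j"
  have "(\<Sum>i\<in>I. \<Sum>j\<in>I. cnj (v i) * A i j * v j)
      = (\<Sum>i\<in>I. \<Sum>j\<in>I. \<Sum>k\<in>J. of_real (h k) * (E i k * cnj (v i)) * (cnj (E j k) * v j))"
    by (intro sum.cong refl) (simp add: A sum_distrib_left sum_distrib_right mult_ac)
  also have "\<dots> = (\<Sum>k\<in>J. \<Sum>i\<in>I. \<Sum>j\<in>I. of_real (h k) * (E i k * cnj (v i)) * (cnj (E j k) * v j))"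
    by (subst (2) sum.swap, subst sum.swap) (rule refl)
  also have "\<dots> = (\<Sum>k\<in>J. of_real (h k) * (cnj (?s k) * ?s k))"
    unfolding cnj_sum complex_cnj_mult complex_cnj_cnj sum_product
    by (simp add: sum_distrib_left mult.assoc)
  also have "\<dots> = of_real (\<Sum>k\<in>J. h k * (cmod (?s k))\<^sup>2)"
    unfolding of_real_sum of_real_mult complex_norm_square by (simp add: mult.commute)
  finally show ?thesis .
qed

text \<open>If the number of linear forms attached to positive weights on the one side and to nonpositive
  weights on the other were smaller than the dimension, these forms would have a nontrivial common
  zero. There the first representation of the Hermitian form is nonpositive, the second
  nonnegative, so all forms of the second one vanish, which contradicts injectivity.\<close>

lemma positive_plus_nonpositive_weights:
  fixes U :: "'i \<Rightarrow> 'l \<Rightarrow> complex" and E :: "'i \<Rightarrow> 'k \<Rightarrow> complex"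
    and a :: "'l \<Rightarrow> real" and h :: "'k \<Rightarrow> real"
  assumes fin: "finite I" "finite L" "finite J"
    and A1: "\<And>i j. i \<in> I \<Longrightarrow> j \<in> I \<Longrightarrow> A i j = (\<Sum>k\<in>L. of_real (a k) * U i k * cnj (U j k))"
    and A2: "\<And>i j. i \<in> I \<Longrightarrow> j \<in> I \<Longrightarrow> A i j = (\<Sum>k\<in>J. of_real (h k) * E i k * cnj (E j k))"
    and inj: "\<And>v. (\<And>k. k \<in> J \<Longrightarrow> (\<Sum>j\<in>I. cnj (E j k) * v j) = 0) \<Longrightarrow> \<forall>i\<in>I. v i = 0"
  shows "card I \<le> card {k\<in>L. a k > 0} + card {k\<in>J. h k \<le> 0}"
proof (rule ccontr)
  assume less: "\<not> ?thesis"
  define K where "K = {k\<in>L. a k > 0} <+> {k\<in>J. h k \<le> 0}"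
  have K: "finite K" "card K < card I" using fin less by (auto simp: K_def card_Plus)
  from homogeneous_system_nontrivial[OF K(1) fin(1) K(2),
      of "\<lambda>k j. case k of Inl k \<Rightarrow> cnj (U j k) | Inr k \<Rightarrow> cnj (E j k)"]
  obtain v where v: "\<exists>i\<in>I. v i \<noteq> 0"
    and U0: "\<And>k. k \<in> L \<Longrightarrow> a k > 0 \<Longrightarrow> (\<Sum>j\<in>I. cnj (U j k) * v j) = 0"
    and E0: "\<And>k. k \<in> J \<Longrightarrow> h k \<le> 0 \<Longrightarrow> (\<Sum>j\<in>I. cnj (E j k) * v j) = 0"
    unfolding K_def by (fastforce simp: Plus_def ball_Un)
  have eq: "(\<Sum>k\<in>L. a k * (cmod (\<Sum>j\<in>I. cnj (U j k) * v j))\<^sup>2)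
          = (\<Sum>k\<in>J. h k * (cmod (\<Sum>j\<in>I. cnj (E j k) * v j))\<^sup>2)" (is "?l = ?r")
    using trans[OF hermitian_form_weighted_squares[where A = A and v = v, OF fin(1,2) A1, symmetric]
        hermitian_form_weighted_squares[where A = A and v = v, OF fin(1,3) A2]]
    unfolding of_real_eq_iff by simp
  have "?l \<le> 0"
  proof (rule sum_nonpos)
    fix k assume "k \<in> L"
    with U0[of k] show "a k * (cmod (\<Sum>j\<in>I. cnj (U j k) * v j))\<^sup>2 \<le> 0"
      by (cases "a k > 0") (auto intro: mult_nonpos_nonneg)
  qed
  moreover have nonneg: "0 \<le> h k * (cmod (\<Sum>j\<in>I. cnj (E j k) * v j))\<^sup>2" if "k \<in> J" for k
    using E0[OF that] by (cases "h k \<le> 0") auto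
  moreover have "?r \<ge> 0" by (rule sum_nonneg) (rule nonneg)
  ultimately have "?r = 0" using eq by linarith
  then have "h k * (cmod (\<Sum>j\<in>I. cnj (E j k) * v j))\<^sup>2 = 0" if "k \<in> J" for k
    using sum_nonneg_eq_0_iff[OF fin(3) nonneg] that by simp
  then have "(\<Sum>j\<in>I. cnj (E j k) * v j) = 0" if "k \<in> J" for k
    using E0[OF that] that by (cases "h k \<le> 0") force+
  from inj[OF this] v show False by blast
qed

section \<open>The spectral theorem for Hermitian matrices\<close>

lemma mat_adjoint_carrier: "A \<in> carrier_mat n m \<Longrightarrow> mat_adjoint A \<in> carrier_mat m n"
  by (auto simp: mat_adjoint_def)

lemma mat_adjoint_index:
  "A \<in> carrier_mat n m \<Longrightarrow> i < m \<Longrightarrow> j < n \<Longrightarrow> mat_adjoint A $$ (i, j) = conjugate (A $$ (j, i))"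
  by (auto simp: mat_adjoint_def mat_of_rows_index)

text \<open>The vector is completed to a basis, which the Gram-Schmidt process makes orthogonal without
  changing the direction of its first member; it remains to normalise the columns.\<close>

lemma unitary_first_column:
  assumes v: "v \<in> carrier_vec n" and v0: "v \<noteq> 0\<^sub>v n"
  obtains W c where "W \<in> carrier_mat n n"
    "mat_adjoint W * W = 1\<^sub>m n" "W * mat_adjoint W = 1\<^sub>m n" "col W 0 = c \<cdot>\<^sub>v (v :: complex vec)"
proof -
  interpret cof_vec_space n "TYPE(complex)" .
  define b where "b = basis_completion v"
  define ws where "ws = gram_schmidt n b"
  from basis_completion[OF v v0, folded b_def]
  have b: "set b \<subseteq> carrier_vec n" "distinct b" "\<not> lin_dep (set b)" "hd b = v" "length b = n"
    by auto
  from gram_schmidt_result[OF b(1-3) refl, folded ws_def] b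
  have ws: "set ws \<subseteq> carrier_vec n" "corthogonal ws" "length ws = n" by auto
  have n: "n > 0" using v v0 by (cases n) auto
  obtain vs where bv: "b = v # vs" using b n by (cases b) auto
  have hd: "hd ws = v" unfolding ws_def bv using gram_schmidt_hd[OF v] .
  have wsi: "ws ! i \<in> carrier_vec n" if "i < n" for i using ws that by auto
  define r where "r = (\<lambda>i. sqrt (Re (ws ! i \<bullet>c ws ! i)))"
  have sq: "ws ! i \<bullet>c ws ! i = of_real (r i * r i)" and r: "r i > 0" if "i < n" for i
  proof -
    have ne: "ws ! i \<bullet>c ws ! i \<noteq> 0" using corthogonalD[OF ws(2), of i i] ws that by simp
    have ge: "ws ! i \<bullet>c ws ! i \<ge> 0" by (rule conjugate_square_ge_0_vec)
    then have eq: "ws ! i \<bullet>c ws ! i = of_real (Re (ws ! i \<bullet>c ws ! i))"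
      by (auto simp: complex_eq_iff less_eq_complex_def)
    with ge ne have "Re (ws ! i \<bullet>c ws ! i) > 0"
      by (auto simp: less_eq_complex_def complex_eq_iff)
    then show "r i > 0" "ws ! i \<bullet>c ws ! i = of_real (r i * r i)"
      using eq by (auto simp: r_def)
  qed
  define W where "W = mat n n (\<lambda>(i, j). ws ! j $ i / of_real (r j))"
  have W: "W \<in> carrier_mat n n" by (simp add: W_def)
  have W': "mat_adjoint W \<in> carrier_mat n n" using W by (rule mat_adjoint_carrier)
  have 1: "mat_adjoint W * W = 1\<^sub>m n"
  proof (rule eq_matI)
    fix i j assume "i < dim_row (1\<^sub>m n)" "j < dim_col (1\<^sub>m n)"
    then have ij: "i < n" "j < n" by auto
    have "(mat_adjoint W * W) $$ (i, j) = (\<Sum>k = 0..<n. cnj (W $$ (k, i)) * W $$ (k, j))"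
      using W W' ij by (simp add: scalar_prod_def mat_adjoint_index[OF W])
    also have "\<dots> = (\<Sum>k = 0..<n. ws ! j $ k * cnj (ws ! i $ k)) / (of_real (r i) * of_real (r j))"
      unfolding sum_divide_distrib using ij by (intro sum.cong) (auto simp: W_def)
    also have "(\<Sum>k = 0..<n. ws ! j $ k * cnj (ws ! i $ k)) = ws ! j \<bullet>c ws ! i"
      using wsi[OF ij(1)] by (auto simp: scalar_prod_def intro!: sum.cong)
    also have "ws ! j \<bullet>c ws ! i / (of_real (r i) * of_real (r j)) = (if i = j then 1 else 0)"
      using corthogonalD[OF ws(2), of j i] ws(3) ij sq[of i] r[of i] by auto
    finally show "(mat_adjoint W * W) $$ (i, j) = 1\<^sub>m n $$ (i, j)" using ij by simp
  qed (use W W' in auto)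
  have 2: "W * mat_adjoint W = 1\<^sub>m n" using mat_mult_left_right_inverse[OF W' W 1] .
  have "col W 0 = (1 / of_real (r 0)) \<cdot>\<^sub>v v"
  proof -
    have "ws ! 0 = v" using n hd ws(3) by (cases ws) auto
    then show ?thesis using n v by (intro eq_vecI) (auto simp: W_def)
  qed
  with that W 1 2 show thesis by blast
qed

lemma mat_adjoint_mult:
  assumes A: "A \<in> carrier_mat n m" and B: "B \<in> carrier_mat m l"
  shows "mat_adjoint (A * B) = mat_adjoint B * mat_adjoint (A :: complex mat)"
proof (rule eq_matI)
  have AB: "A * B \<in> carrier_mat n l" using A B by simp
  note c = mat_adjoint_carrier[OF A] mat_adjoint_carrier[OF B] mat_adjoint_carrier[OF AB]
  show "dim_row (mat_adjoint (A * B)) = dim_row (mat_adjoint B * mat_adjoint A)"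
    "dim_col (mat_adjoint (A * B)) = dim_col (mat_adjoint B * mat_adjoint A)"
    using c by auto
  fix i j assume "i < dim_row (mat_adjoint B * mat_adjoint A)" "j < dim_col (mat_adjoint B * mat_adjoint A)"
  then have ij: "i < l" "j < n" using c by auto
  have "mat_adjoint (A * B) $$ (i, j) = cnj ((A * B) $$ (j, i))"
    using ij by (simp add: mat_adjoint_index[OF AB])
  also have "\<dots> = (\<Sum>k = 0..<m. cnj (A $$ (j, k)) * cnj (B $$ (k, i)))"
    using A B ij by (simp add: scalar_prod_def)
  also have "\<dots> = (mat_adjoint B * mat_adjoint A) $$ (i, j)"
    using A B ij c
    by (simp add: scalar_prod_def mat_adjoint_index[OF A] mat_adjoint_index[OF B] mult.commute)
  finally show "mat_adjoint (A * B) $$ (i, j) = (mat_adjoint B * mat_adjoint A) $$ (i, j)" .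
qed

lemma mat_adjoint_adjoint:
  assumes "A \<in> carrier_mat n m"
  shows "mat_adjoint (mat_adjoint A) = (A :: complex mat)"
  using assms mat_adjoint_carrier[OF assms] mat_adjoint_carrier[OF mat_adjoint_carrier[OF assms]]
  by (intro eq_matI)
    (auto simp: mat_adjoint_index[OF assms] mat_adjoint_index[OF mat_adjoint_carrier[OF assms]])

text \<open>The inductive step of the spectral theorem: a unitary matrix whose first column is an eigenvector
  turns the first column of \<open>A\<close> into a multiple of the first unit vector; as the transformed matrix
  is still Hermitian, its first row has the same shape and the eigenvalue is real.\<close>

lemma hermitian_deflation:
  assumes A: "A \<in> carrier_mat (Suc n) (Suc n)" and herm: "mat_adjoint A = (A :: complex mat)"
  obtains W B e A' where "W \<in> carrier_mat (Suc n) (Suc n)" "A' \<in> carrier_mat n n"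
    "mat_adjoint A' = A'"
    "B = four_block_mat (mat 1 1 (\<lambda>_. of_real e)) (0\<^sub>m 1 n) (0\<^sub>m n 1) A'"
    "A = W * B * mat_adjoint W" "char_poly A = char_poly B"
proof -
  from char_poly_factorized[OF A] obtain as
    where as: "char_poly A = (\<Prod>a\<leftarrow>as. [:- a, 1:])" "length as = Suc n" by blast
  then obtain e as' where "as = e # as'" by (cases as) auto
  with as have "eigenvalue A e" unfolding eigenvalue_root_char_poly[OF A] by simp
  then obtain v where v: "v \<in> carrier_vec (Suc n)" "v \<noteq> 0\<^sub>v (Suc n)" and Av: "A *\<^sub>v v = e \<cdot>\<^sub>v v"
    using A unfolding eigenvalue_def eigenvector_def by auto
  obtain W c where W: "W \<in> carrier_mat (Suc n) (Suc n)"
    and un: "mat_adjoint W * W = 1\<^sub>m (Suc n)" "W * mat_adjoint W = 1\<^sub>m (Suc n)"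
    and col: "col W 0 = c \<cdot>\<^sub>v v"
    using unitary_first_column[OF v] by blast
  have W': "mat_adjoint W \<in> carrier_mat (Suc n) (Suc n)" using W by (rule mat_adjoint_carrier)
  define B where "B = mat_adjoint W * A * W"
  have B: "B \<in> carrier_mat (Suc n) (Suc n)" using A W W' by (simp add: B_def)
  have AB: "A = W * B * mat_adjoint W"
  proof -
    have "W * B * mat_adjoint W = (W * mat_adjoint W) * A * (W * mat_adjoint W)"
      unfolding B_def using A W W' by (simp add: assoc_mult_mat[of _ "Suc n" "Suc n" _ "Suc n" _ "Suc n"])
    then show ?thesis using A by (simp add: un)
  qed
  have "similar_mat_wit A B W (mat_adjoint W)"
    by (rule similar_mat_witI[OF un(2,1) AB A B W W'])
  then have cp: "char_poly A = char_poly B"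
    by (intro char_poly_similar) (auto simp: similar_mat_def)
  have Bherm: "mat_adjoint B = B"
  proof -
    have "mat_adjoint B = mat_adjoint W * (A * W)"
      unfolding B_def
      by (simp add: mat_adjoint_mult[OF mult_carrier_mat[OF W' A] W] mat_adjoint_mult[OF W' A]
          mat_adjoint_adjoint[OF W] herm)
    then show ?thesis unfolding B_def using A W W' by simp
  qed
  have Bsym: "B $$ (i, j) = cnj (B $$ (j, i))" if "i < Suc n" "j < Suc n" for i j
    using mat_adjoint_index[OF B that] Bherm by simp
  have col0: "col B 0 = e \<cdot>\<^sub>v unit_vec (Suc n) 0"
  proof -
    have Wcol: "col W 0 \<in> carrier_vec (Suc n)" using W by (metis col_dim carrier_matD(1))
    have "col B 0 = mat_adjoint W *\<^sub>v (A *\<^sub>v col W 0)"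
      unfolding B_def assoc_mult_mat[OF W' A W]
      unfolding col_mult2[OF W' mult_carrier_mat[OF A W] zero_less_Suc] col_mult2[OF A W zero_less_Suc] ..
    also have "A *\<^sub>v col W 0 = e \<cdot>\<^sub>v col W 0"
      unfolding col using A v(1)
      unfolding mult_mat_vec[OF A v(1)] Av smult_smult_assoc by (simp add: mult.commute)
    also have "mat_adjoint W *\<^sub>v \<dots> = e \<cdot>\<^sub>v (mat_adjoint W *\<^sub>v col W 0)"
      by (rule mult_mat_vec[OF W' Wcol])
    also have "mat_adjoint W *\<^sub>v col W 0 = col (mat_adjoint W * W) 0"
      by (rule col_mult2[OF W' W, symmetric]) simp
    finally show ?thesis by (simp add: un)
  qed
  have B0: "B $$ (i, 0) = (if i = 0 then e else 0)" if "i < Suc n" for i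
  proof -
    have "B $$ (i, 0) = col B 0 $ i" using that B by simp
    also have "\<dots> = (if i = 0 then e else 0)" unfolding col0 using that by simp
    finally show ?thesis .
  qed
  have B0': "B $$ (0, j) = (if j = 0 then e else 0)" if "j < Suc n" for j
    using Bsym[of 0 j] Bsym[of 0 0] B0[of j] B0[of 0] that by auto
  have e: "e = of_real (Re e)"
    using Bsym[of 0 0] B0[of 0] by (auto simp: complex_eq_iff)
  define A' where "A' = mat n n (\<lambda>(i, j). B $$ (Suc i, Suc j))"
  have A': "A' \<in> carrier_mat n n" by (simp add: A'_def)
  have herm': "mat_adjoint A' = A'"
  proof (rule eq_matI)
    fix i j assume "i < dim_row A'" "j < dim_col A'"
    then have ij: "i < n" "j < n" using A' by auto
    show "mat_adjoint A' $$ (i, j) = A' $$ (i, j)"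
      unfolding mat_adjoint_index[OF A' ij] using ij Bsym[of "Suc i" "Suc j"] by (simp add: A'_def)
  qed (use A' mat_adjoint_carrier[OF A'] in auto)
  have "B = four_block_mat (mat 1 1 (\<lambda>_. e)) (0\<^sub>m 1 n) (0\<^sub>m n 1) A'"
    using B A' by (intro eq_matI) (auto simp: B0 B0' A'_def)
  then have "B = four_block_mat (mat 1 1 (\<lambda>_. of_real (Re e))) (0\<^sub>m 1 n) (0\<^sub>m n 1) A'"
    using e by simp
  from that[OF W A' herm' this AB cp] show thesis .
qed

text \<open>The form in which the spectral theorem serves to count eigenvalues by sign: the roots of the
  characteristic polynomial, with multiplicity, are the weights in a representation of the Hermitian
  form as a weighted sum of squares.\<close>

theorem hermitian_spectral_decomposition:
  assumes "A \<in> carrier_mat n n" and "mat_adjoint A = (A :: complex mat)"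
  shows "\<exists>lam :: nat \<Rightarrow> real. \<exists>U. char_poly A = (\<Prod>k<n. [:- of_real (lam k), 1:]) \<and>
    (\<forall>i<n. \<forall>j<n. A $$ (i, j) = (\<Sum>k<n. of_real (lam k) * U i k * cnj (U j k)))"
  using assms
proof (induction n arbitrary: A)
  case 0
  then have "degree (char_poly A) = 0" "coeff (char_poly A) 0 = 1"
    using degree_monic_char_poly[OF 0(1)] by simp_all
  then have "char_poly A = 1" by (metis degree_0_id of_nat_1 one_pCons)
  then show ?case by simp
next
  case (Suc n)
  from hermitian_deflation[OF Suc.prems] obtain W B e A' where
    W: "W \<in> carrier_mat (Suc n) (Suc n)" and A': "A' \<in> carrier_mat n n" "mat_adjoint A' = A'"
    and B: "B = four_block_mat (mat 1 1 (\<lambda>_. of_real e)) (0\<^sub>m 1 n) (0\<^sub>m n 1) A'"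
    and AB: "A = W * B * mat_adjoint W" and cp: "char_poly A = char_poly B" by metis
  from Suc.IH[OF A'] obtain lam U where
    cp': "char_poly A' = (\<Prod>k<n. [:- of_real (lam k), 1:])" and
    U: "\<And>i j. i < n \<Longrightarrow> j < n \<Longrightarrow> A' $$ (i, j) = (\<Sum>k<n. of_real (lam k) * U i k * cnj (U j k))"
    by blast
  \<comment> \<open>The columns of \<open>W\<close> times the block diagonal matrix with blocks \<open>1\<close> and \<open>U\<close>.\<close>
  let ?lam = "\<lambda>k. case k of 0 \<Rightarrow> e | Suc k \<Rightarrow> lam k"
  let ?V = "\<lambda>i k. case k of 0 \<Rightarrow> W $$ (i, 0) | Suc k \<Rightarrow> \<Sum>l<n. W $$ (i, Suc l) * U l k"
  have "char_poly A = char_poly (mat 1 1 (\<lambda>_. complex_of_real e)) * char_poly A'"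
    unfolding cp B using A' by (intro char_poly_four_block_zeros_col) auto
  also have "char_poly (mat 1 1 (\<lambda>_. complex_of_real e)) = [:- of_real e, 1:]"
    by (simp add: char_poly_defs det_def sign_def)
  finally have 1: "char_poly A = (\<Prod>k<Suc n. [:- of_real (?lam k), 1:])"
    unfolding cp' prod.lessThan_Suc_shift by simp
  have 2: "A $$ (i, j) = (\<Sum>k<Suc n. of_real (?lam k) * ?V i k * cnj (?V j k))"
    if "i < Suc n" "j < Suc n" for i j
  proof -
    have Bc: "B \<in> carrier_mat (Suc n) (Suc n)" unfolding B using A' by auto
    have "A $$ (i, j) = (\<Sum>q<Suc n. (\<Sum>p<Suc n. W $$ (i, p) * B $$ (p, q)) * cnj (W $$ (j, q)))"
      unfolding AB using that W Bc mat_adjoint_carrier[OF W]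
      by (simp add: scalar_prod_def mat_adjoint_index[OF W] lessThan_atLeast0
          del: sum.op_ivl_Suc assoc_mult_mat)
    also have "\<dots> = W $$ (i, 0) * of_real e * cnj (W $$ (j, 0)) +
        (\<Sum>q<n. (\<Sum>p<n. W $$ (i, Suc p) * A' $$ (p, q)) * cnj (W $$ (j, Suc q)))"
      unfolding sum.lessThan_Suc_shift B using A' by simp
    also have "(\<Sum>q<n. (\<Sum>p<n. W $$ (i, Suc p) * A' $$ (p, q)) * cnj (W $$ (j, Suc q)))
        = (\<Sum>q<n. \<Sum>p<n. \<Sum>k<n. of_real (lam k) * (W $$ (i, Suc p) * U p k) *
            cnj (W $$ (j, Suc q) * U q k))"
      by (simp add: U sum_distrib_left sum_distrib_right mult_ac)
    also have "\<dots> = (\<Sum>k<n. \<Sum>p<n. \<Sum>q<n. of_real (lam k) * (W $$ (i, Suc p) * U p k) *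
            cnj (W $$ (j, Suc q) * U q k))"
      by (subst (2) sum.swap, subst sum.swap, subst (2) sum.swap) (rule refl)
    also have "\<dots> = (\<Sum>k<n. of_real (lam k) * ?V i (Suc k) * cnj (?V j (Suc k)))"
      by (simp add: sum_distrib_left sum_distrib_right mult_ac)
    finally show ?thesis unfolding sum.lessThan_Suc_shift by (simp add: mult_ac)
  qed
  from 1 2 show ?case by (intro exI[of _ ?lam] exI[of _ ?V]) blast
qed

section \<open>Inertia from a representation by weighted squares\<close>

lemma order_prod_linear_factors:
  assumes "finite K"
  shows "Polynomial.order z (\<Prod>k\<in>K. [:- a k, 1:]) = card {k\<in>K. a k = (z :: 'a :: idom)}"
  using assms
proof (induction K rule: finite_induct)
  case (insert k K)
  have nz: "[:- a k, 1:] * (\<Prod>k\<in>K. [:- a k, 1:]) \<noteq> 0"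
    unfolding mult_eq_0_iff prod_zero_iff[OF insert.hyps(1)] by simp
  have "{l\<in>insert k K. a l = z} = (if a k = z then insert k {l\<in>K. a l = z} else {l\<in>K. a l = z})"
    by auto
  then show ?case
    unfolding prod.insert[OF insert.hyps] order_mult[OF nz] insert.IH order_linear'
    using insert.hyps by simp
qed simp

lemma sum_order_real_eigenvalues:
  fixes lam :: "nat \<Rightarrow> real"
  assumes A: "A \<in> carrier_mat n n" and cp: "char_poly A = (\<Prod>k<n. [:- complex_of_real (lam k), 1:])"
  shows "(\<Sum>r | eigenvalue A (complex_of_real r) \<and> P r. Polynomial.order (complex_of_real r) (char_poly A))
       = card {k. k < n \<and> P (lam k)}"
proof -
  let ?N = "{k. k < n \<and> P (lam k)}"
  have "{r. eigenvalue A (complex_of_real r) \<and> P r} = lam ` ?N"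
    unfolding eigenvalue_root_char_poly[OF A] cp by (auto simp: poly_prod)
  moreover have "Polynomial.order (complex_of_real r) (char_poly A) = card {k\<in>?N. lam k = r}" if "r \<in> lam ` ?N" for r
    unfolding cp order_prod_linear_factors[OF finite_lessThan]
    using that by (intro arg_cong[of _ _ card]) auto
  ultimately have "(\<Sum>r | eigenvalue A (complex_of_real r) \<and> P r. Polynomial.order (complex_of_real r) (char_poly A))
      = (\<Sum>r\<in>lam ` ?N. \<Sum>k\<in>{k\<in>?N. lam k = r}. 1)" by simp
  also have "\<dots> = card ?N"
    using sum.image_gen[of ?N "\<lambda>_. 1 :: nat" lam] by simp
  finally show ?thesis .
qed

text \<open>The injectivity hypothesis says that the linear forms belonging to the columns of \<open>E\<close> separate
  vectors; the index set \<open>J\<close> may be larger than the dimension. The second bound is the first one for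
  \<open>- A\<close>.\<close>

theorem inertia_of_weighted_squares:
  fixes E :: "nat \<Rightarrow> 'k \<Rightarrow> complex" and h :: "'k \<Rightarrow> real"
  assumes A: "A \<in> carrier_mat n n" and J: "finite J"
    and rep: "\<And>i j. i < n \<Longrightarrow> j < n \<Longrightarrow> A $$ (i, j) = (\<Sum>k\<in>J. of_real (h k) * E i k * cnj (E j k))"
    and inj: "\<And>v. (\<And>k. k \<in> J \<Longrightarrow> (\<Sum>j<n. cnj (E j k) * v j) = 0) \<Longrightarrow> \<forall>i<n. v i = 0"
  shows "n \<le> i_plus A + card {k\<in>J. h k \<le> 0}"
    and "n \<le> i_minus A + card {k\<in>J. h k \<ge> 0}"
    and "i_plus A + i_minus A + i_zero A = n"
proof -
  have "mat_adjoint A = A"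
  proof (rule eq_matI)
    fix i j assume "i < dim_row A" "j < dim_col A"
    then have "i < n" "j < n" using A by auto
    then show "mat_adjoint A $$ (i, j) = A $$ (i, j)"
      by (simp add: mat_adjoint_index[OF A] rep mult_ac)
  qed (use A mat_adjoint_carrier[OF A] in auto)
  from hermitian_spectral_decomposition[OF A this] obtain lam :: "nat \<Rightarrow> real" and U where
    cp: "char_poly A = (\<Prod>k<n. [:- of_real (lam k), 1:])" and
    U: "\<And>i j. i < n \<Longrightarrow> j < n \<Longrightarrow> A $$ (i, j) = (\<Sum>k<n. of_real (lam k) * U i k * cnj (U j k))"
    by blast
  note count = sum_order_real_eigenvalues[OF A cp]
  have plus: "i_plus A = card {k. k < n \<and> lam k > 0}" unfolding i_plus_def by (rule count)
  have minus: "i_minus A = card {k. k < n \<and> lam k < 0}" unfolding i_minus_def by (rule count)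
  have zero: "i_zero A = card {k. k < n \<and> lam k = 0}" unfolding i_zero_def by (rule count)
  let ?P = "{k. k < n \<and> lam k > 0}" and ?M = "{k. k < n \<and> lam k < 0}" and ?Z = "{k. k < n \<and> lam k = 0}"
  have "{..<n} = ?P \<union> ?M \<union> ?Z" by auto
  moreover have "card (?P \<union> ?M \<union> ?Z) = card (?P \<union> ?M) + card ?Z"
    by (rule card_Un_disjoint) auto
  moreover have "card (?P \<union> ?M) = card ?P + card ?M"
    by (rule card_Un_disjoint) auto
  ultimately show "i_plus A + i_minus A + i_zero A = n"
    unfolding plus minus zero by (metis card_lessThan)
  have inj': "\<forall>i\<in>{..<n}. v i = 0" if "\<And>k. k \<in> J \<Longrightarrow> (\<Sum>j<n. cnj (E j k) * v j) = 0" for v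
    using inj[OF that] by auto
  have "card {..<n} \<le> card {k\<in>{..<n}. lam k > 0} + card {k\<in>J. h k \<le> 0}"
    by (rule positive_plus_nonpositive_weights
        [where A = "\<lambda>i j. A $$ (i, j)" and U = U and E = E, OF _ _ J _ _ inj'])
      (simp_all add: U[symmetric] rep[symmetric])
  then show "n \<le> i_plus A + card {k\<in>J. h k \<le> 0}" by (simp add: plus)
  have "card {..<n} \<le> card {k\<in>{..<n}. - lam k > 0} + card {k\<in>J. - h k \<le> 0}"
    by (rule positive_plus_nonpositive_weights
        [where A = "\<lambda>i j. - A $$ (i, j)" and U = U and E = E, OF _ _ J _ _ inj'])
      (simp_all add: sum_negf U[symmetric] rep[symmetric])
  then show "n \<le> i_minus A + card {k\<in>J. h k \<ge> 0}" by (simp add: minus)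
qed

section \<open>Common unitary divisors and the unitary Jordan function\<close>

lemma unitary_divisor_iff_multiplicity:
  assumes a: "a > 0"
  shows "unitary_divisor d a \<longleftrightarrow>
    d > 0 \<and> (\<forall>p. prime p \<longrightarrow> multiplicity p d = 0 \<or> multiplicity p d = multiplicity p a)"
proof
  assume ud: "unitary_divisor d a"
  then have d: "d dvd a" "coprime d (a div d)" by (auto simp: unitary_divisor_def)
  have pos: "d > 0" "a div d > 0"
    using dvd_pos_nat[OF a d(1)] dvd_imp_le[OF d(1) a] by (simp_all add: div_greater_zero_iff)
  have "multiplicity p d = multiplicity p a" if p: "prime p" and "multiplicity p d \<noteq> 0" for p
  proof -
    have "p dvd d" using that(2) not_dvd_imp_multiplicity_0[of p d] by argo
    then have "\<not> p dvd a div d" using coprime_common_divisor[OF d(2), of p] not_prime_unit[of p] p by argo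
    then have "multiplicity p (a div d) = 0" by (rule not_dvd_imp_multiplicity_0)
    moreover have "multiplicity p (d * (a div d)) = multiplicity p d + multiplicity p (a div d)"
      using p pos by (intro prime_elem_multiplicity_mult_distrib) auto
    ultimately show ?thesis using d(1) by simp
  qed
  with pos show "d > 0 \<and> (\<forall>p. prime p \<longrightarrow> multiplicity p d = 0 \<or> multiplicity p d = multiplicity p a)"
    by blast
next
  assume R: "d > 0 \<and> (\<forall>p. prime p \<longrightarrow> multiplicity p d = 0 \<or> multiplicity p d = multiplicity p a)"
  then have "d dvd a" using a
    by (intro multiplicity_le_imp_dvd) (blast, metis le0 order_refl)
  have pos: "a div d > 0"
    using R dvd_imp_le[OF \<open>d dvd a\<close> a] by (simp add: div_greater_zero_iff)
  have "coprime d (a div d)"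
  proof (rule ccontr)
    assume "\<not> coprime d (a div d)"
    then obtain p where p: "prime p" "p dvd d" "p dvd a div d"
      using prime_factor_nat[of "gcd d (a div d)"] by (auto simp: coprime_iff_gcd_eq_1)
    have "multiplicity p (d * (a div d)) = multiplicity p d + multiplicity p (a div d)"
      using p R pos by (intro prime_elem_multiplicity_mult_distrib) auto
    moreover have "multiplicity p d > 0" "multiplicity p (a div d) > 0"
      using p R pos by (auto simp: prime_multiplicity_gt_zero_iff)
    ultimately show False using R p(1) \<open>d dvd a\<close> by (metis add_cancel_right_right dvd_mult_div_cancel less_numeral_extra(3))
  qed
  with \<open>d dvd a\<close> a show "unitary_divisor d a" by (simp add: unitary_divisor_def)
qed

text \<open>For a set \<open>T\<close> of prime divisors of \<open>a\<close>, this is the unitary divisor of \<open>a\<close> with exactly these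
  prime divisors.\<close>

definition unitary_part :: "nat \<Rightarrow> nat set \<Rightarrow> nat" where
  "unitary_part a T = (\<Prod>p\<in>T. p ^ multiplicity p a)"

definition shared_primes :: "nat \<Rightarrow> nat \<Rightarrow> nat set" where
  "shared_primes a b = {p \<in> prime_factors a. multiplicity p a = multiplicity p b}"

lemma finite_shared_primes [simp]: "finite (shared_primes a b)"
  by (simp add: shared_primes_def)

context
  fixes a :: nat and T :: "nat set"
  assumes a: "a > 0" and T: "T \<subseteq> prime_factors a"
begin

lemma unitary_part_pos: "unitary_part a T > 0"
  using T by (auto simp: unitary_part_def prime_factors_multiplicity prime_gt_0_nat intro!: prod_pos)

lemma multiplicity_unitary_part:
  "prime p \<Longrightarrow> multiplicity p (unitary_part a T) = (if p \<in> T then multiplicity p a else 0)"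
  using T unfolding unitary_part_def
  by (intro multiplicity_prod_prime_powers) (auto intro: finite_subset)

lemma prime_factors_unitary_part: "prime_factors (unitary_part a T) = T"
  using T multiplicity_unitary_part by (auto simp: prime_factors_multiplicity split: if_splits)

end

text \<open>A unitary divisor takes over each of its prime powers at full multiplicity, so a common one can
  only use primes at which \<open>a\<close> and \<open>b\<close> have the same multiplicity, and for those it is free to
  choose.\<close>

lemma common_unitary_divisors_bij:
  assumes a: "a > 0" and b: "b > 0"
  shows "bij_betw (unitary_part a) (Pow (shared_primes a b))
    {d. unitary_divisor d a \<and> unitary_divisor d b}"
proof (rule bij_betw_byWitness[where f' = prime_factors])
  have sub: "T \<subseteq> prime_factors a" if "T \<in> Pow (shared_primes a b)" for T
    using that by (auto simp: shared_primes_def)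
  show "\<forall>T\<in>Pow (shared_primes a b). prime_factors (unitary_part a T) = T"
    using prime_factors_unitary_part[OF a] sub by blast
  show "unitary_part a ` Pow (shared_primes a b) \<subseteq> {d. unitary_divisor d a \<and> unitary_divisor d b}"
  proof (clarify, intro conjI)
    fix T assume T: "T \<subseteq> shared_primes a b"
    then have T': "T \<subseteq> prime_factors a" using sub by blast
    note m = unitary_part_pos[OF a T'] multiplicity_unitary_part[OF a T']
    show "unitary_divisor (unitary_part a T) a" "unitary_divisor (unitary_part a T) b"
      unfolding unitary_divisor_iff_multiplicity[OF a] unitary_divisor_iff_multiplicity[OF b]
      using m T by (auto simp: shared_primes_def)
  qed
  {
    fix d assume d: "unitary_divisor d a" "unitary_divisor d b"
    then have pos: "d > 0" and ma: "\<And>p. p \<in> prime_factors d \<Longrightarrow> multiplicity p d = multiplicity p a"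
      and mb: "\<And>p. p \<in> prime_factors d \<Longrightarrow> multiplicity p d = multiplicity p b"
      unfolding unitary_divisor_iff_multiplicity[OF a] unitary_divisor_iff_multiplicity[OF b]
      by (auto simp: prime_factors_multiplicity)
    have "prime_factors d \<subseteq> shared_primes a b"
    proof
      fix p assume p: "p \<in> prime_factors d"
      from ma[OF p] mb[OF p] p show "p \<in> shared_primes a b"
        by (simp add: shared_primes_def prime_factors_multiplicity)
    qed
    moreover have "unitary_part a (prime_factors d) = d"
    proof -
      have "unitary_part a (prime_factors d) = (\<Prod>p\<in>prime_factors d. p ^ multiplicity p d)"
        unfolding unitary_part_def using ma by (intro prod.cong) auto
      also have "\<dots> = d" by (rule prime_factorization_nat[OF pos, symmetric])
      finally show ?thesis .
    qed
    ultimately have "prime_factors d \<in> Pow (shared_primes a b) \<and> unitary_part a (prime_factors d) = d"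
      by blast
  }
  then show "\<forall>d\<in>{d. unitary_divisor d a \<and> unitary_divisor d b}. unitary_part a (prime_factors d) = d"
    "prime_factors ` {d. unitary_divisor d a \<and> unitary_divisor d b} \<subseteq> Pow (shared_primes a b)"
    by blast+
qed

lemma gcud_eq_unitary_part:
  assumes a: "a > 0" and b: "b > 0"
  shows "gcud a b = unitary_part a (shared_primes a b)"
proof -
  note im = bij_betw_imp_surj_on[OF common_unitary_divisors_bij[OF a b], symmetric]
  have "unitary_part a T \<le> unitary_part a (shared_primes a b)" if "T \<subseteq> shared_primes a b" for T
  proof (rule dvd_imp_le)
    show "unitary_part a T dvd unitary_part a (shared_primes a b)"
      unfolding unitary_part_def by (rule prod_dvd_prod_subset) (use that in auto)
    show "unitary_part a (shared_primes a b) > 0"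
      by (rule unitary_part_pos[OF a]) (auto simp: shared_primes_def)
  qed
  then show ?thesis unfolding gcud_def im by (intro Max_eqI) auto
qed

lemma gcud_unitary_divisor:
  assumes "a > 0" "b > 0"
  shows "unitary_divisor (gcud a b) a"
  using bij_betw_imp_surj_on[OF common_unitary_divisors_bij[OF assms]]
  unfolding gcud_eq_unitary_part[OF assms] by blast

text \<open>The unitary analogue of Jordan's totient function, with a real exponent: the function
  whose sum over the unitary divisors of \<open>a\<close> is \<open>a powr s\<close>.\<close>

definition unitary_jordan :: "real \<Rightarrow> nat \<Rightarrow> real" where
  "unitary_jordan s d = (\<Prod>p\<in>prime_factors d. real (p ^ multiplicity p d) powr s - 1)"

text \<open>By the parametrisation of common unitary divisors this is the expansion of
  \<open>\<Prod>\<^sub>p ((q\<^sub>p - 1) + 1)\<close>, where \<open>q\<^sub>p\<close> is the power with exponent \<open>s\<close> of the \<open>p\<close>-part of the gcud.\<close>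

lemma sum_unitary_jordan_common_divisors:
  assumes a: "a > 0" and b: "b > 0"
  shows "(\<Sum>d | unitary_divisor d a \<and> unitary_divisor d b. unitary_jordan s d) = real (gcud a b) powr s"
proof -
  let ?T = "shared_primes a b" and ?q = "\<lambda>p. real (p ^ multiplicity p a) powr s"
  have "(\<Sum>d | unitary_divisor d a \<and> unitary_divisor d b. unitary_jordan s d)
      = (\<Sum>T\<in>Pow ?T. unitary_jordan s (unitary_part a T))"
    by (rule sum.reindex_bij_betw[OF common_unitary_divisors_bij[OF a b], symmetric])
  also have "\<dots> = (\<Sum>T\<in>Pow ?T. (\<Prod>p\<in>T. ?q p - 1))"
  proof (rule sum.cong[OF refl])
    fix T assume "T \<in> Pow ?T"
    then have T: "T \<subseteq> prime_factors a" by (auto simp: shared_primes_def)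
    show "unitary_jordan s (unitary_part a T) = (\<Prod>p\<in>T. ?q p - 1)"
      unfolding unitary_jordan_def prime_factors_unitary_part[OF a T]
      using T by (intro prod.cong refl)
        (auto simp: multiplicity_unitary_part[OF a T] in_prime_factors_imp_prime)
  qed
  also have "\<dots> = (\<Prod>p\<in>?T. (?q p - 1) + 1)"
    by (subst prod_add) auto
  also have "\<dots> = real (gcud a b) powr s"
    unfolding gcud_eq_unitary_part[OF a b] unitary_part_def by (simp add: prod_powr_distrib)
  finally show ?thesis .
qed

lemma prime_factor_power_gt_1:
  assumes "p \<in> prime_factors d"
  shows "real (p ^ multiplicity p d) > 1"
proof -
  have "prime p" "multiplicity p d > 0" using assms by (auto simp: prime_factors_multiplicity)
  then have "p ^ multiplicity p d > 1" by (intro one_less_power prime_gt_1_nat)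
  then have "real 1 < real (p ^ multiplicity p d)" by (rule of_nat_less_iff[THEN iffD2])
  then show ?thesis by (simp only: of_nat_1)
qed

lemma unitary_jordan_pos:
  assumes "s > 0"
  shows "unitary_jordan s d > 0"
  unfolding unitary_jordan_def
proof (rule prod_pos)
  fix p assume "p \<in> prime_factors d"
  from prime_factor_power_gt_1[OF this] show "real (p ^ multiplicity p d) powr s - 1 > 0"
    using assms gr_one_powr by simp
qed

lemma unitary_jordan_sign:
  assumes "s < 0"
  shows "even (omega d) \<Longrightarrow> unitary_jordan s d > 0" "odd (omega d) \<Longrightarrow> unitary_jordan s d < 0"
proof -
  let ?q = "\<lambda>p. 1 - real (p ^ multiplicity p d) powr s"
  have "unitary_jordan s d = (\<Prod>p\<in>prime_factors d. - ?q p)"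
    by (simp add: unitary_jordan_def)
  also have "\<dots> = (- 1) ^ omega d * (\<Prod>p\<in>prime_factors d. ?q p)"
    unfolding omega_def by (rule prod_uminus)
  finally have eq: "unitary_jordan s d = (- 1) ^ omega d * (\<Prod>p\<in>prime_factors d. ?q p)" .
  have "(\<Prod>p\<in>prime_factors d. ?q p) > 0"
  proof (rule prod_pos)
    fix p assume "p \<in> prime_factors d"
    from powr_less_mono[OF assms prime_factor_power_gt_1[OF this]] prime_factor_power_gt_1[OF this]
    show "?q p > 0" by (auto split: if_splits)
  qed
  with eq show "even (omega d) \<Longrightarrow> unitary_jordan s d > 0" "odd (omega d) \<Longrightarrow> unitary_jordan s d < 0"
    by auto
qed

section \<open>Inertia of the gcud and pseudo-LCUM matrices\<close>

text \<open>Among the indices with \<open>v i \<noteq> 0\<close>, the one with the largest \<open>x i\<close> survives alone in the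
  equation belonging to \<open>d = x i\<close>, because proper multiples of \<open>x i\<close> are larger.\<close>

lemma unitary_divisibility_injective:
  fixes x :: "nat \<Rightarrow> nat" and v c :: "nat \<Rightarrow> 'a :: idom"
  assumes x_pos: "\<And>i. i < n \<Longrightarrow> x i > 0" and inj: "inj_on x {..<n}"
    and c: "\<And>i. i < n \<Longrightarrow> c i \<noteq> 0"
    and eqs: "\<And>k. k < n \<Longrightarrow> (\<Sum>j<n. (if unitary_divisor (x k) (x j) then c j else 0) * v j) = 0"
  shows "\<forall>i<n. v i = 0"
proof (rule ccontr)
  define N where "N = {i. i < n \<and> v i \<noteq> 0}"
  assume "\<not> ?thesis"
  then have "finite (x ` N)" "x ` N \<noteq> {}" by (auto simp: N_def)
  then obtain i where i: "i \<in> N" and "x i = Max (x ` N)"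
    using Max_in by (metis imageE)
  then have max: "x j \<le> x i" if "j \<in> N" for j using \<open>finite (x ` N)\<close> that by simp
  from i have i': "i < n" "v i \<noteq> 0" by (auto simp: N_def)
  have self: "unitary_divisor (x i) (x i)" using x_pos[OF i'(1)] by (simp add: unitary_divisor_def)
  have "(if unitary_divisor (x i) (x j) then c j else 0) * v j = 0" if "j < n" "j \<noteq> i" for j
  proof (rule ccontr)
    assume "\<not> ?thesis"
    then have "unitary_divisor (x i) (x j)" "j \<in> N" using that by (auto simp: N_def split: if_splits)
    then have "x i \<le> x j" "x j \<le> x i" using max by (auto simp: unitary_divisor_def dvd_imp_le)
    then show False using inj that i' by (auto dest: inj_onD)
  qed
  then have "(\<Sum>j\<in>{..<n} - {i}. (if unitary_divisor (x i) (x j) then c j else 0) * v j) = 0"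
    by (intro sum.neutral) auto
  then have "(\<Sum>j<n. (if unitary_divisor (x i) (x j) then c j else 0) * v j) = c i * v i"
    using i' self by (subst sum.remove[of _ i]) auto
  then show False using eqs[OF i'(1)] c[OF i'(1)] i'(2) by simp
qed

text \<open>The scaling by \<open>c\<close> is a congruence by a diagonal matrix and is absorbed into the linear forms.\<close>

theorem inertia_scaled_gcud_power:
  fixes x :: "nat \<Rightarrow> nat" and c :: "nat \<Rightarrow> real"
  assumes A: "A \<in> carrier_mat n n"
    and A_eq: "\<And>i j. i < n \<Longrightarrow> j < n \<Longrightarrow>
      A $$ (i, j) = complex_of_real (c i * c j * real (gcud (x i) (x j)) powr s)"
    and x_pos: "\<And>i. i < n \<Longrightarrow> x i > 0" and inj: "inj_on x {..<n}"
    and c: "\<And>i. i < n \<Longrightarrow> c i \<noteq> 0"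
    and J: "finite J" and UD: "\<And>i d. i < n \<Longrightarrow> unitary_divisor d (x i) \<Longrightarrow> d \<in> J"
  shows "n \<le> i_plus A + card {d\<in>J. unitary_jordan s d \<le> 0}"
    and "n \<le> i_minus A + card {d\<in>J. unitary_jordan s d \<ge> 0}"
    and "i_plus A + i_minus A + i_zero A = n"
proof -
  let ?E = "\<lambda>i d. complex_of_real (if unitary_divisor d (x i) then c i else 0)"
  have rep: "A $$ (i, j) = (\<Sum>d\<in>J. of_real (unitary_jordan s d) * ?E i d * cnj (?E j d))"
    if ij: "i < n" "j < n" for i j
  proof -
    let ?D = "{d. unitary_divisor d (x i) \<and> unitary_divisor d (x j)}"
    have "(\<Sum>d\<in>J. of_real (unitary_jordan s d) * ?E i d * cnj (?E j d))
        = (\<Sum>d\<in>?D. of_real (unitary_jordan s d * (c i * c j)))"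
      using UD[OF ij(1)] by (intro sum.mono_neutral_cong_right J) auto
    also have "\<dots> = of_real ((\<Sum>d\<in>?D. unitary_jordan s d) * (c i * c j))"
      by (simp add: sum_distrib_right)
    also have "\<dots> = A $$ (i, j)"
      unfolding sum_unitary_jordan_common_divisors[OF x_pos[OF ij(1)] x_pos[OF ij(2)]] A_eq[OF ij]
      by (simp add: mult_ac)
    finally show ?thesis ..
  qed
  have inj': "\<forall>i<n. v i = 0" if v: "\<And>d. d \<in> J \<Longrightarrow> (\<Sum>j<n. cnj (?E j d) * v j) = 0" for v
  proof (rule unitary_divisibility_injective[OF x_pos inj, where c = "\<lambda>i. of_real (c i)"])
    fix k assume k: "k < n"
    then have "x k \<in> J" using x_pos by (intro UD[of k]) (auto simp: unitary_divisor_def)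
    from v[OF this]
    show "(\<Sum>j<n. (if unitary_divisor (x k) (x j) then complex_of_real (c j) else 0) * v j) = 0"
      by (simp add: if_distrib[of complex_of_real] if_distrib[of cnj] cong: if_cong)
  qed (use c in auto)
  note inertia = inertia_of_weighted_squares[where E = ?E, OF A J]
  show "n \<le> i_plus A + card {d\<in>J. unitary_jordan s d \<le> 0}"
    by (rule inertia(1)) (fact rep, fact inj')
  show "n \<le> i_minus A + card {d\<in>J. unitary_jordan s d \<ge> 0}"
    by (rule inertia(2)) (fact rep, fact inj')
  show "i_plus A + i_minus A + i_zero A = n"
    by (rule inertia(3)) (fact rep, fact inj')
qed

lemma powr_pseudo_lcum:
  assumes "a > 0" "b > 0"
  shows "real (pseudo_lcum a b) > 0"
    and "real (pseudo_lcum a b) powr (- m) = real a powr (- m) * real b powr (- m) * real (gcud a b) powr m"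
proof -
  have dvd: "gcud a b dvd a" using gcud_unitary_divisor[OF assms] by (simp add: unitary_divisor_def)
  have g: "gcud a b > 0" using dvd assms(1) by (rule dvd_pos_nat[rotated])
  have eq: "real (pseudo_lcum a b) = real a * real b / real (gcud a b)"
    using dvd by (simp add: pseudo_lcum_def real_of_nat_div)
  show "real (pseudo_lcum a b) > 0" unfolding eq using assms g by simp
  show "real (pseudo_lcum a b) powr (- m) = real a powr (- m) * real b powr (- m) * real (gcud a b) powr m"
    unfolding eq using assms g by (simp add: powr_divide powr_mult powr_minus field_simps)
qed

theorem theorem4p4:
  fixes m :: real and f :: "real \<Rightarrow> real"
    and n :: nat and x :: "nat \<Rightarrow> nat" and S :: "nat set"
  assumes m_pos: "m > 0"
    and f_eq: "\<And>t. t > 0 \<Longrightarrow> f t = t powr (- m)"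
    and x_pos: "\<And>i. i < n \<Longrightarrow> x i > 0"
    and x_distinct: "inj_on x {..<n}"
    and S_eq: "S = x ` {..<n}"
  shows "(i_plus (pseudo_lcum_mat f n x) = n
           \<and> i_minus (pseudo_lcum_mat f n x) = 0
           \<and> i_zero (pseudo_lcum_mat f n x) = 0)
       \<and> (UD_closed S \<longrightarrow>
             i_plus (gcud_mat f n x) = card {a \<in> S. even (omega a)}
           \<and> i_minus (gcud_mat f n x) = card {a \<in> S. odd (omega a)}
           \<and> i_zero (gcud_mat f n x) = 0)"
proof (intro conjI impI)
  let ?L = "pseudo_lcum_mat f n x"
  let ?J = "{d. \<exists>i<n. unitary_divisor d (x i)}"
  have "?J \<subseteq> (\<Union>i<n. {..x i})" by (auto simp: unitary_divisor_def dvd_imp_le)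
  then have J: "finite ?J" by (rule finite_subset) auto
  have L: "?L \<in> carrier_mat n n" by (simp add: pseudo_lcum_mat_def)
  have L_eq: "?L $$ (i, j) = complex_of_real
      (real (x i) powr (- m) * real (x j) powr (- m) * real (gcud (x i) (x j)) powr m)"
    if "i < n" "j < n" for i j
    using that powr_pseudo_lcum[OF x_pos[OF that(1)] x_pos[OF that(2)]]
    by (simp add: pseudo_lcum_mat_def f_eq)
  have scale: "real (x i) powr (- m) \<noteq> 0" if "i < n" for i using x_pos[OF that] by simp
  have UD: "d \<in> ?J" if "i < n" "unitary_divisor d (x i)" for i d using that by blast
  note inertia = inertia_scaled_gcud_power[where s = m and c = "\<lambda>i. real (x i) powr (- m)", OF L]
  have "n \<le> i_plus ?L + card {d \<in> ?J. unitary_jordan m d \<le> 0}"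
    by (rule inertia(1)) (fact L_eq x_pos x_distinct scale J UD)+
  moreover have "{d \<in> ?J. unitary_jordan m d \<le> 0} = {}"
    using unitary_jordan_pos[OF m_pos] by (auto simp: not_le)
  ultimately have "n \<le> i_plus ?L" by (simp only: card.empty add_0_right)
  moreover have "i_plus ?L + i_minus ?L + i_zero ?L = n"
    by (rule inertia(3)) (fact L_eq x_pos x_distinct scale J UD)+
  ultimately
  show "i_plus ?L = n" "i_minus ?L = 0" "i_zero ?L = 0" by auto
next
  let ?G = "gcud_mat f n x"
  assume UD: "UD_closed S"
  have S: "finite S" "card S = n" using x_distinct by (auto simp: S_eq card_image)
  have G: "?G \<in> carrier_mat n n" by (simp add: gcud_mat_def)
  have G_eq: "?G $$ (i, j) = complex_of_real (1 * 1 * real (gcud (x i) (x j)) powr (- m))"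
    if "i < n" "j < n" for i j
  proof -
    have "gcud (x i) (x j) > 0"
      using gcud_unitary_divisor[OF x_pos[OF that(1)] x_pos[OF that(2)]] x_pos[OF that(1)]
      by (auto simp: unitary_divisor_def intro: dvd_pos_nat)
    then show ?thesis using that by (simp add: gcud_mat_def f_eq)
  qed
  have closed: "d \<in> S" if "i < n" "unitary_divisor d (x i)" for i d
    using UD that by (auto simp: UD_closed_def S_eq)
  have one: "(1 :: real) \<noteq> 0" if "i < n" for i by simp
  note inertia = inertia_scaled_gcud_power[where s = "- m" and c = "\<lambda>_. 1", OF G]
  have "- m < 0" using m_pos by simp
  note sign = unitary_jordan_sign[OF this]
  have nonpos: "unitary_jordan (- m) d \<le> 0 \<longleftrightarrow> odd (omega d)"
    and nonneg: "unitary_jordan (- m) d \<ge> 0 \<longleftrightarrow> even (omega d)" for d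
    using sign[of d] by (cases "even (omega d)"; simp)+
  have "n \<le> i_plus ?G + card {d \<in> S. unitary_jordan (- m) d \<le> 0}"
    by (rule inertia(1)) (fact G_eq x_pos x_distinct one S(1) closed)+
  then have "n \<le> i_plus ?G + card {d \<in> S. odd (omega d)}" by (simp only: nonpos)
  moreover have "n \<le> i_minus ?G + card {d \<in> S. unitary_jordan (- m) d \<ge> 0}"
    by (rule inertia(2)) (fact G_eq x_pos x_distinct one S(1) closed)+
  then have "n \<le> i_minus ?G + card {d \<in> S. even (omega d)}" by (simp only: nonneg)
  moreover have "i_plus ?G + i_minus ?G + i_zero ?G = n"
    by (rule inertia(3)) (fact G_eq x_pos x_distinct one S(1) closed)+
  moreover have "card {d \<in> S. even (omega d)} + card {d \<in> S. odd (omega d)} = n"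
  proof -
    have "S = {d \<in> S. even (omega d)} \<union> {d \<in> S. odd (omega d)}" by auto
    then have "card S = card {d \<in> S. even (omega d)} + card {d \<in> S. odd (omega d)}"
      using S(1) by (subst card_Un_disjoint[symmetric]) auto
    then show ?thesis using S(2) by simp
  qed
  ultimately show "i_plus ?G = card {a \<in> S. even (omega a)}"
    "i_minus ?G = card {a \<in> S. odd (omega a)}" "i_zero ?G = 0" by auto
qed

end
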